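(* Let $P=(p_n)$ and $Q=(q_n)$ be basic sequences. Then $\psi_{P,Q}$ is monotone on no intervals (that is, there is no non-degenerate interval in $\mathbb{R}$ on which $\psi_{P,Q}$ is monotone) if and only if $p_n>q_n$ for infinitely many $n$.
   Context: A basic sequence is a sequence of integers $\ge2$. The $P$-Cantor series expansion of $x\in\mathbb{R}$, abbreviated $x=E_0.E_1E_2\cdots$ w.r.t. $P$, is the unique expansion $x=E_0+\sum_{n\ge1}\frac{E_n}{p_1\cdots p_n}$ with $E_0=\lfloor x\rfloor$, $E_n\in\{0,\ldots,p_n-1\}$ for $n\ge 1$, and $E_n\ne p_n-1$ infinitely often. For such $x$, $\psi_{P,Q}(x)=\sum_{n\ge1}\frac{\min(E_n,q_n-1)}{q_1\cdots q_n}$. *)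

theory Defs
  imports "HOL-Analysis.Analysis"
begin

(* Sequences are indexed from 1; the value at index 0 is irrelevant. *)
definition basic_sequence :: "(nat \<Rightarrow> int) \<Rightarrow> bool" where
  "basic_sequence P \<longleftrightarrow> (\<forall>n\<ge>1. P n \<ge> 2)"

(* The series over n \<ge> 1 is written with Suc n for n \<ge> 0. *)
definition cantor_expansion :: "(nat \<Rightarrow> int) \<Rightarrow> real \<Rightarrow> (nat \<Rightarrow> int) \<Rightarrow> bool" where
  "cantor_expansion P x E \<longleftrightarrow>
     E 0 = \<lfloor>x\<rfloor> \<and>
     (\<forall>n\<ge>1. E n \<in> {0..P n - 1}) \<and>
     infinite {n. n \<ge> 1 \<and> E n \<noteq> P n - 1} \<and>
     (\<lambda>n. real_of_int (E (Suc n)) / real_of_int (\<Prod>i=1..Suc n. P i)) sums (x - real_of_int (E 0))"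

definition cantor_digits :: "(nat \<Rightarrow> int) \<Rightarrow> real \<Rightarrow> nat \<Rightarrow> int" where
  "cantor_digits P x = (THE E. cantor_expansion P x E)"

definition psi :: "(nat \<Rightarrow> int) \<Rightarrow> (nat \<Rightarrow> int) \<Rightarrow> real \<Rightarrow> real" where
  "psi P Q x =
     (\<Sum>n. real_of_int (min (cantor_digits P x (Suc n)) (Q (Suc n) - 1))
             / real_of_int (\<Prod>i=1..Suc n. Q i))"

lemma basic_prod_ge:
  assumes "basic_sequence P"
  shows "real_of_int (\<Prod>i=1..n. P i) \<ge> 2 ^ n"
proof (induction n)
  case (Suc n)
  have "real_of_int (P (Suc n)) \<ge> 2"
    using assms by (auto simp: basic_sequence_def)
  then have "2 ^ n * 2 \<le> real_of_int (\<Prod>i=1..n. P i) * real_of_int (P (Suc n))"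
    using Suc order_trans[OF zero_le_power[of 2 n] Suc] by (intro mult_mono) auto
  then show ?case by (simp add: mult.commute)
qed simp

lemma cantor_expansion_step:
  assumes P: "basic_sequence P" and E: "cantor_expansion P x E"
  shows "E (Suc n) = \<lfloor>real_of_int (P (Suc n)) * (real_of_int (\<Prod>i=1..n. P i) *
           (x - real_of_int (E 0) - (\<Sum>k<n. real_of_int (E (Suc k)) / real_of_int (\<Prod>i=1..Suc k. P i))))\<rfloor>"
proof -
  define A where "A n = real_of_int (\<Prod>i=1..n. P i)" for n
  define f where "f k = real_of_int (E (Suc k)) / A (Suc k)" for k
  define t where "t n = A n * (x - real_of_int (E 0) - (\<Sum>k<n. f k))" for n
  have Ap: "A n > 0" for n
    using basic_prod_ge[OF P, of n] unfolding A_def by (smt (verit) zero_less_power)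
  have AS: "A (Suc n) = A n * real_of_int (P (Suc n))" for n
    by (simp add: A_def mult.commute)
  have Pp: "real_of_int (P (Suc n)) \<ge> 2" for n
    using P by (auto simp: basic_sequence_def)
  have Er: "0 \<le> E (Suc n)" "E (Suc n) \<le> P (Suc n) - 1" for n
    using E by (auto simp: cantor_expansion_def)
  have sm: "f sums (x - real_of_int (E 0))"
    using E unfolding cantor_expansion_def f_def A_def by blast
  have f0: "f k \<ge> 0" for k
    using Er(1)[of k] Ap[of "Suc k"] by (simp add: f_def)
  have fle: "f k \<le> 1 / A k - 1 / A (Suc k)" for k
  proof -
    have "f k \<le> (real_of_int (P (Suc k)) - 1) / A (Suc k)"
      unfolding f_def using Er(2)[of k] Ap[of "Suc k"] by (intro divide_right_mono) linarith+
    also have "\<dots> = 1 / A k - 1 / A (Suc k)"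
      using Ap[of k] Pp[of k] by (simp add: AS field_simps)
    finally show ?thesis .
  qed
  have t0: "t n \<ge> 0" for n
  proof -
    have "(\<Sum>k<n. f k) \<le> x - real_of_int (E 0)"
      using sum_le_suminf[of f "{..<n}"] sm f0 by (simp add: sums_iff)
    then show ?thesis unfolding t_def using Ap[of n] by simp
  qed
  have t1: "t n \<le> 1" for n
  proof -
    have b: "(\<Sum>k<m. f k) \<le> (\<Sum>k<n. f k) + 1 / A n - 1 / A m" if "m \<ge> n" for m
      using that
    proof (induction m rule: dec_induct)
      case (step m) then show ?case using fle[of m] by simp
    qed simp
    have "(\<lambda>m. \<Sum>k<m. f k) \<longlonglongrightarrow> x - real_of_int (E 0)"
      using sm by (simp add: sums_def)
    moreover have "\<forall>m\<ge>n. (\<Sum>k<m. f k) \<le> (\<Sum>k<n. f k) + 1 / A n"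
      using b Ap by (smt (verit) divide_pos_pos)
    ultimately have "x - real_of_int (E 0) \<le> (\<Sum>k<n. f k) + 1 / A n"
      by (intro LIMSEQ_le_const2) auto
    then have "x - real_of_int (E 0) - (\<Sum>k<n. f k) \<le> 1 / A n" by simp
    then show ?thesis unfolding t_def using Ap[of n] by (simp add: field_simps)
  qed
  have tS: "t (Suc n) = real_of_int (P (Suc n)) * t n - real_of_int (E (Suc n))" for n
  proof -
    have "A (Suc n) * f n = real_of_int (E (Suc n))"
      using Ap[of "Suc n"] by (simp add: f_def)
    then show ?thesis by (simp add: t_def AS algebra_simps)
  qed
  have tne: "t n \<noteq> 1" for n
  proof
    assume a: "t n = 1"
    have st: "t m = 1 \<Longrightarrow> E (Suc m) = P (Suc m) - 1 \<and> t (Suc m) = 1" for m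
      using tS[of m] t1[of "Suc m"] Er(2)[of m] by simp
    have all1: "t m = 1" if "m \<ge> n" for m
      using that by (induction m rule: dec_induct) (use a st in auto)
    have "E m = P m - 1" if "m > n" for m
      using st[of "m - 1"] all1[of "m - 1"] that by (cases m) auto
    then have "{n. n \<ge> 1 \<and> E n \<noteq> P n - 1} \<subseteq> {..n}"
      by (auto simp: not_less[symmetric])
    then have "finite {n. n \<ge> 1 \<and> E n \<noteq> P n - 1}"
      by (rule finite_subset) simp
    then show False using E by (simp add: cantor_expansion_def)
  qed
  have "E (Suc n) = \<lfloor>real_of_int (P (Suc n)) * t n\<rfloor>"
    using tS[of n] t0[of "Suc n"] t1[of "Suc n"] tne[of "Suc n"] by linarith
  then show ?thesis by (simp add: t_def f_def A_def)
qed

lemma cantor_expansion_unique: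
  assumes P: "basic_sequence P" and E: "cantor_expansion P x E" and F: "cantor_expansion P x F"
  shows "E = F"
proof
  fix n show "E n = F n"
  proof (induction n rule: less_induct)
    case (less n)
    show ?case
    proof (cases n)
      case 0
      then show ?thesis using E F by (simp add: cantor_expansion_def)
    next
      case (Suc m)
      have "(\<Sum>k<m. real_of_int (E (Suc k)) / real_of_int (\<Prod>i=1..Suc k. P i)) =
            (\<Sum>k<m. real_of_int (F (Suc k)) / real_of_int (\<Prod>i=1..Suc k. P i))"
        using less Suc by (intro sum.cong) auto
      moreover have "E 0 = F 0" using less Suc by simp
      ultimately show ?thesis
        unfolding Suc cantor_expansion_step[OF P E, of m] cantor_expansion_step[OF P F, of m]
        by simp
    qed
  qed
qed

lemma cantor_expansion_exists:
  assumes P: "basic_sequence P"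
  shows "\<exists>E. cantor_expansion P x E"
proof -
  define A where "A n = (\<Prod>i=1..n. P i)" for n
  define E where "E n = (if n = 0 then \<lfloor>x\<rfloor>
     else \<lfloor>x * real_of_int (A n)\<rfloor> - P n * \<lfloor>x * real_of_int (A (n - 1))\<rfloor>)" for n
  define r where "r n = x * real_of_int (A n) - real_of_int \<lfloor>x * real_of_int (A n)\<rfloor>" for n
  have Ag: "real_of_int (A n) \<ge> 2 ^ n" for n
    using basic_prod_ge[OF P, of n] by (simp add: A_def)
  have Ap: "real_of_int (A n) > 0" for n
    using Ag[of n] by (smt (verit) zero_less_power)
  have AS: "A (Suc n) = A n * P (Suc n)" for n
    by (simp add: A_def mult.commute)
  have Pp: "real_of_int (P (Suc n)) \<ge> 2" for n
    using P by (auto simp: basic_sequence_def)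
  have r: "0 \<le> r n" "r n < 1" for n unfolding r_def by linarith+
  have rS: "r (Suc n) = real_of_int (P (Suc n)) * r n - real_of_int (E (Suc n))" for n
    by (simp add: r_def E_def AS algebra_simps)
  have Er: "E (Suc n) \<in> {0..P (Suc n) - 1}" for n
  proof -
    have "0 \<le> real_of_int (P (Suc n)) * r n" using r Pp[of n] by simp
    moreover have "real_of_int (P (Suc n)) * r n < real_of_int (P (Suc n))"
      using r[of n] Pp[of n] by simp
    ultimately show ?thesis using rS[of n] r[of "Suc n"] by simp
  qed
  have ps: "(\<Sum>k<n. real_of_int (E (Suc k)) / real_of_int (A (Suc k)))
              = x - real_of_int (E 0) - r n / real_of_int (A n)" for n
  proof (induction n)
    case 0 then show ?case by (simp add: E_def r_def A_def)
  next
    case (Suc n)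
    have "real_of_int (E (Suc n)) / real_of_int (A (Suc n))
          = r n / real_of_int (A n) - r (Suc n) / real_of_int (A (Suc n))"
      unfolding rS AS using Ap[of n] Pp[of n] by (simp add: field_simps)
    then show ?case using Suc by simp
  qed
  have lim: "(\<lambda>n. r n / real_of_int (A n)) \<longlonglongrightarrow> 0"
  proof (rule tendsto_sandwich[of "\<lambda>_. 0" _ _ "\<lambda>n. (1/2) ^ n"])
    show "\<forall>\<^sub>F n in sequentially. 0 \<le> r n / real_of_int (A n)"
      using r Ap by (simp add: less_imp_le)
    have "r n / real_of_int (A n) \<le> (1/2) ^ n" for n
    proof -
      have "r n / real_of_int (A n) \<le> 1 / 2 ^ n"
        using r[of n] Ag[of n] by (intro frac_le) auto
      then show ?thesis by (simp add: power_divide)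
    qed
    then show "\<forall>\<^sub>F n in sequentially. r n / real_of_int (A n) \<le> (1/2) ^ n" by simp
  qed (auto intro: LIMSEQ_power_zero)
  have "(\<lambda>n. real_of_int (E (Suc n)) / real_of_int (A (Suc n))) sums (x - real_of_int (E 0))"
    unfolding sums_def ps using tendsto_diff[OF tendsto_const lim] by simp
  moreover have "infinite {n. n \<ge> 1 \<and> E n \<noteq> P n - 1}"
  proof
    assume "finite {n. n \<ge> 1 \<and> E n \<noteq> P n - 1}"
    then obtain N where N: "\<And>n. n \<ge> 1 \<Longrightarrow> E n \<noteq> P n - 1 \<Longrightarrow> n \<le> N"
      using finite_nat_set_iff_bounded_le by auto
    have "1 - r (N + m) \<ge> 2 ^ m * (1 - r N)" for m
    proof (induction m)
      case (Suc m)
      have "E (Suc (N + m)) = P (Suc (N + m)) - 1" using N[of "Suc (N + m)"] by auto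
      then have "1 - r (Suc (N + m)) = real_of_int (P (Suc (N + m))) * (1 - r (N + m))"
        using rS[of "N + m"] by (simp add: algebra_simps)
      also have "\<dots> \<ge> 2 * (1 - r (N + m))"
        using Pp[of "N + m"] r[of "N + m"] by (intro mult_right_mono) auto
      finally show ?case using Suc by simp
    qed simp
    then have b: "2 ^ m * (1 - r N) \<le> 1" for m
      using r(1)[of "N + m"] by (smt (verit))
    obtain m where "1 / (1 - r N) < 2 ^ m" using real_arch_pow[of 2] by auto
    then have "1 < 2 ^ m * (1 - r N)" using r(2)[of N] by (simp add: field_simps)
    with b[of m] show False by simp
  qed
  moreover have "E n \<in> {0..P n - 1}" if "n \<ge> 1" for n
    using Er[of "n - 1"] that by simp
  ultimately have "cantor_expansion P x E"
    by (simp add: cantor_expansion_def A_def) (simp add: E_def)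
  then show ?thesis by (rule exI[of _ E])
qed

lemma cantor_expansion_ex1: "basic_sequence P \<Longrightarrow> \<exists>!E. cantor_expansion P x E"
  using cantor_expansion_exists cantor_expansion_unique by blast

lemma cantor_digits_expansion:
  "basic_sequence P \<Longrightarrow> cantor_expansion P x (cantor_digits P x)"
  unfolding cantor_digits_def by (rule theI'[OF cantor_expansion_ex1])

end

(* On a cylinder all of whose free positions satisfy p_n <= q_n no digit is truncated, so psi
   respects the lexicographic order of the digits and is increasing there.  If p_n > q_n, the
   digits q_n - 1 and q_n in position n are both mapped to q_n - 1.  Inside every cylinder of
   order n - 1 consider the points with continuation (q_n - 1, 0), (q_n - 1, 1) and (q_n, 0),
   followed by zeros: they are increasing, the first and the last have the same image, and the
   image of the middle one is larger.  Such cylinders occur in every interval. *)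
theory Submission
  imports Defs
begin

section \<open>Estimates for series of digit sequences\<close>

definition cantor_base :: "(nat \<Rightarrow> int) \<Rightarrow> nat \<Rightarrow> real" where
  "cantor_base P n = real_of_int (\<Prod>i=1..n. P i)"

definition cantor_term :: "(nat \<Rightarrow> int) \<Rightarrow> (nat \<Rightarrow> int) \<Rightarrow> nat \<Rightarrow> real" where
  "cantor_term P E k = real_of_int (E (Suc k)) / cantor_base P (Suc k)"

text \<open>Only the range of the digits is recorded: truncated digits may end in a tail of maximal
  digits \<open>Q n - 1\<close>, and the estimates must cover them too.\<close>

definition admissible :: "(nat \<Rightarrow> int) \<Rightarrow> (nat \<Rightarrow> int) \<Rightarrow> bool" where
  "admissible P E \<longleftrightarrow> (\<forall>n\<ge>1. E n \<in> {0..P n - 1})"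

lemma cantor_base_0 [simp]: "cantor_base P 0 = 1"
  by (simp add: cantor_base_def)

lemma cantor_base_Suc: "cantor_base P (Suc n) = cantor_base P n * real_of_int (P (Suc n))"
  by (simp add: cantor_base_def mult.commute)

lemma basic_sequence_ge: "basic_sequence P \<Longrightarrow> 2 \<le> P (Suc n)"
  by (simp add: basic_sequence_def)

lemma admissible_Suc: "admissible P E \<Longrightarrow> 0 \<le> E (Suc n) \<and> E (Suc n) \<le> P (Suc n) - 1"
  by (auto simp: admissible_def)

lemma cantor_base_ge: "basic_sequence P \<Longrightarrow> 2 ^ n \<le> cantor_base P n"
  using basic_prod_ge by (simp add: cantor_base_def)

lemma cantor_base_pos: "basic_sequence P \<Longrightarrow> 0 < cantor_base P n"
  using cantor_base_ge[of P n] by (smt (verit) zero_less_power)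

lemma cantor_base_mono:
  assumes "basic_sequence P" "m \<le> n"
  shows "cantor_base P m \<le> cantor_base P n"
  using assms(2)
proof (induction n rule: dec_induct)
  case (step n)
  have "cantor_base P n * 1 \<le> cantor_base P n * real_of_int (P (Suc n))"
    using basic_sequence_ge[OF assms(1), of n] cantor_base_pos[OF assms(1), of n]
    by (intro mult_left_mono) auto
  with step show ?case by (simp add: cantor_base_Suc)
qed simp

lemma cantor_term_nonneg:
  "basic_sequence P \<Longrightarrow> admissible P E \<Longrightarrow> 0 \<le> cantor_term P E k"
  using admissible_Suc[of P E k] cantor_base_pos[of P "Suc k"] by (simp add: cantor_term_def)

text \<open>The largest digit \<open>P (Suc k) - 1\<close> gives exactly this difference, so the
  bounds telescope.\<close>

lemma cantor_term_le:
  assumes "basic_sequence P" "admissible P E"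
  shows "cantor_term P E k \<le> 1 / cantor_base P k - 1 / cantor_base P (Suc k)"
proof -
  have "cantor_term P E k \<le> (real_of_int (P (Suc k)) - 1) / cantor_base P (Suc k)"
    unfolding cantor_term_def
    using admissible_Suc[OF assms(2), of k] cantor_base_pos[OF assms(1), of "Suc k"]
    by (intro divide_right_mono) linarith+
  also have "\<dots> = 1 / cantor_base P k - 1 / cantor_base P (Suc k)"
    using cantor_base_pos[OF assms(1), of k] basic_sequence_ge[OF assms(1), of k]
    by (simp add: cantor_base_Suc field_simps)
  finally show ?thesis .
qed

text \<open>Telescoping sum of \<open>cantor_term_le\<close>. The last summand is kept because it
  makes finite sums strictly less than 1.\<close>

lemma cantor_partial_sum_le:
  assumes "basic_sequence P" "admissible P E" "n \<le> m"
  shows "(\<Sum>k<m. cantor_term P E k)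
           \<le> (\<Sum>k<n. cantor_term P E k) + 1 / cantor_base P n - 1 / cantor_base P m"
  using assms(3)
proof (induction m rule: dec_induct)
  case (step m)
  then show ?case using cantor_term_le[OF assms(1,2), of m] by simp
qed simp

lemma cantor_term_summable:
  assumes "basic_sequence P" "admissible P E"
  shows "summable (cantor_term P E)"
proof (rule summableI_nonneg_bounded)
  show "(\<Sum>k<n. cantor_term P E k) \<le> 1" for n
    using cantor_partial_sum_le[OF assms, of 0 n] cantor_base_pos[OF assms(1), of n]
    by (smt (verit) cantor_base_0 div_by_1 divide_pos_pos lessThan_0 sum.empty le0)
qed (rule cantor_term_nonneg[OF assms])

lemma cantor_value_ge:
  assumes "basic_sequence P" "admissible P E"
  shows "(\<Sum>k<n. cantor_term P E k) \<le> suminf (cantor_term P E)"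
  by (rule sum_le_suminf) (auto simp: cantor_term_summable cantor_term_nonneg assms)

lemma cantor_value_le:
  assumes "basic_sequence P" "admissible P E"
  shows "suminf (cantor_term P E) \<le> (\<Sum>k<n. cantor_term P E k) + 1 / cantor_base P n"
proof (rule LIMSEQ_le_const2)
  show "(\<lambda>m. \<Sum>k<m. cantor_term P E k) \<longlonglongrightarrow> suminf (cantor_term P E)"
    using cantor_term_summable[OF assms] by (rule summable_LIMSEQ)
  have "(\<Sum>k<m. cantor_term P E k) \<le> (\<Sum>k<n. cantor_term P E k) + 1 / cantor_base P n"
    if "n \<le> m" for m
    using cantor_partial_sum_le[OF assms that] cantor_base_pos[OF assms(1), of m]
    by (smt (verit) divide_pos_pos)
  then show "\<exists>N. \<forall>m\<ge>N. (\<Sum>k<m. cantor_term P E k)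
      \<le> (\<Sum>k<n. cantor_term P E k) + 1 / cantor_base P n" by blast
qed

text \<open>All digits of \<open>E\<close> after the first difference add at most one unit
  \<open>1 / cantor_base P (Suc n)\<close>, which the larger digit of \<open>F\<close> already
  supplies. Equality can occur when \<open>E\<close> ends in maximal digits and \<open>F\<close> in
  zeros.\<close>

lemma cantor_value_lex:
  assumes P: "basic_sequence P" and E: "admissible P E" and F: "admissible P F"
    and eq: "\<And>k. k < n \<Longrightarrow> E (Suc k) = F (Suc k)" and less: "E (Suc n) < F (Suc n)"
  shows "suminf (cantor_term P E) \<le> suminf (cantor_term P F)"
proof -
  have "suminf (cantor_term P E)
      \<le> (\<Sum>k<n. cantor_term P E k) + real_of_int (E (Suc n) + 1) / cantor_base P (Suc n)"
    using cantor_value_le[OF P E, of "Suc n"] by (simp add: cantor_term_def add_divide_distrib)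
  also have "\<dots> \<le> (\<Sum>k<n. cantor_term P E k) + cantor_term P F n"
    unfolding cantor_term_def[of P F] using less cantor_base_pos[OF P, of "Suc n"]
    by (intro add_left_mono divide_right_mono) auto
  also have "\<dots> = (\<Sum>k<Suc n. cantor_term P F k)"
    by (simp add: cantor_term_def eq)
  also have "\<dots> \<le> suminf (cantor_term P F)"
    by (rule cantor_value_ge[OF P F])
  finally show ?thesis .
qed

section \<open>Digits of real numbers and the map \<open>psi\<close>\<close>

lemma cantor_expansion_iff:
  "cantor_expansion P x E \<longleftrightarrow> E 0 = \<lfloor>x\<rfloor> \<and> admissible P E \<and>
     infinite {n. n \<ge> 1 \<and> E n \<noteq> P n - 1} \<and> cantor_term P E sums (x - real_of_int (E 0))"
  unfolding cantor_expansion_def admissible_def cantor_term_def[abs_def] cantor_base_def by simp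

lemma
  assumes "basic_sequence P"
  shows cantor_digits_0: "cantor_digits P x 0 = \<lfloor>x\<rfloor>"
    and cantor_digits_admissible: "admissible P (cantor_digits P x)"
    and cantor_digits_suminf: "suminf (cantor_term P (cantor_digits P x)) = x - real_of_int \<lfloor>x\<rfloor>"
  using cantor_digits_expansion[OF assms, of x] by (auto simp: cantor_expansion_iff sums_iff)

lemma psi_eq_suminf:
  "psi P Q x = suminf (cantor_term Q (\<lambda>n. min (cantor_digits P x n) (Q n - 1)))"
  unfolding psi_def cantor_term_def[abs_def] cantor_base_def by simp

lemma admissible_min:
  "basic_sequence Q \<Longrightarrow> admissible P E \<Longrightarrow> admissible Q (\<lambda>n. min (E n) (Q n - 1))"
  by (fastforce simp: admissible_def basic_sequence_def)

text \<open>A nonzero digit in a position up to \<open>N\<close> would alone contribute at least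
  \<open>1 / cantor_base P N\<close>.\<close>

lemma cantor_digits_zero:
  assumes P: "basic_sequence P" and x: "0 \<le> x" "x < 1 / cantor_base P N" and "k < N"
  shows "cantor_digits P x (Suc k) = 0"
proof -
  let ?E = "cantor_digits P x"
  note adm = cantor_digits_admissible[OF P, of x]
  have "cantor_term P ?E k \<le> (\<Sum>j<Suc k. cantor_term P ?E j)"
    using cantor_term_nonneg[OF P adm] by (simp add: sum_nonneg)
  also have "\<dots> \<le> x - real_of_int \<lfloor>x\<rfloor>"
    using cantor_value_ge[OF P adm, of "Suc k"] cantor_digits_suminf[OF P, of x]
    by (simp del: sum.lessThan_Suc)
  also have "\<dots> \<le> x" using x(1) by simp
  also have "x < 1 / cantor_base P N" by (rule x)
  also have "\<dots> \<le> 1 / cantor_base P (Suc k)"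
    using \<open>k < N\<close> cantor_base_mono[OF P, of "Suc k" N] cantor_base_pos[OF P]
    by (intro divide_left_mono) auto
  finally have "?E (Suc k) < 1"
    using cantor_base_pos[OF P, of "Suc k"] by (simp add: cantor_term_def divide_less_cancel)
  then show ?thesis using admissible_Suc[OF adm, of k] by simp
qed

text \<open>The first \<open>N\<close> digits vanish on this interval, so two expansions can first
  differ only in a position where truncation changes nothing.\<close>

lemma psi_mono_on_cylinder:
  assumes P: "basic_sequence P" and Q: "basic_sequence Q" and le: "\<And>n. N < n \<Longrightarrow> P n \<le> Q n"
  shows "mono_on {0..<1 / cantor_base P N} (psi P Q)"
proof (rule mono_onI)
  fix x y assume x: "x \<in> {0..<1 / cantor_base P N}" and y: "y \<in> {0..<1 / cantor_base P N}"
    and "x \<le> y"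
  let ?E = "cantor_digits P x" and ?F = "cantor_digits P y"
  note admE = cantor_digits_admissible[OF P, of x] and admF = cantor_digits_admissible[OF P, of y]
  have "1 / cantor_base P N \<le> 1"
    using cantor_base_mono[OF P, of 0 N] by simp
  then have fl: "\<lfloor>x\<rfloor> = 0" "\<lfloor>y\<rfloor> = 0" using x y by (auto simp: floor_eq_iff)
  show "psi P Q x \<le> psi P Q y"
  proof (cases "\<forall>k. ?E (Suc k) = ?F (Suc k)")
    case True
    then show ?thesis by (simp add: psi_def)
  next
    case False
    define n where "n = (LEAST k. ?E (Suc k) \<noteq> ?F (Suc k))"
    have ne: "?E (Suc n) \<noteq> ?F (Suc n)"
      unfolding n_def by (rule LeastI_ex) (use False in auto)
    have eq: "?E (Suc k) = ?F (Suc k)" if "k < n" for k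
      using not_less_Least[of k] that unfolding n_def by blast
    have "N \<le> n"
      using ne cantor_digits_zero[OF P, of x N n] cantor_digits_zero[OF P, of y N n] x y
      by (cases "n < N") auto
    \<comment> \<open>The opposite order would give \<open>y \<le> x\<close>, hence
      \<open>x = y\<close>, although the digits differ.\<close>
    have "?E (Suc n) < ?F (Suc n)"
    proof (rule ccontr)
      assume "\<not> ?thesis"
      then have "?F (Suc n) < ?E (Suc n)" using ne by simp
      then have "suminf (cantor_term P ?F) \<le> suminf (cantor_term P ?E)"
        using eq by (intro cantor_value_lex[OF P admF admE, of n]) auto
      then have "x = y" using \<open>x \<le> y\<close> fl by (simp add: cantor_digits_suminf[OF P])
      then show False using ne by simp
    qed
    moreover have "P (Suc n) \<le> Q (Suc n)" using le \<open>N \<le> n\<close> by simp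
    \<comment> \<open>Both digits are at most \<open>P (Suc n) - 1 \<le> Q (Suc n) - 1\<close>, so
      neither is truncated.\<close>
    ultimately have "min (?E (Suc n)) (Q (Suc n) - 1) < min (?F (Suc n)) (Q (Suc n) - 1)"
      using admissible_Suc[OF admF, of n] by simp
    then show ?thesis
      unfolding psi_eq_suminf using eq
      by (intro cantor_value_lex[OF Q admissible_min[OF Q admE] admissible_min[OF Q admF], of n]) auto
  qed
qed

section \<open>Points with finite expansions\<close>

lemma cantor_term_eventually_zero_sums:
  assumes "\<And>n. M < n \<Longrightarrow> E n = 0"
  shows "cantor_term P E sums (\<Sum>k<M. cantor_term P E k)"
  by (rule sums_finite) (auto simp: cantor_term_def assms)

text \<open>A tail of zeros satisfies the condition on infinitely many non-maximal digits, since
  \<open>P n - 1 \<ge> 1\<close>; uniqueness of the expansion does the rest.\<close>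

lemma cantor_digits_finite_expansion:
  assumes P: "basic_sequence P" and E: "admissible P E" and z: "\<And>n. M < n \<Longrightarrow> E n = 0"
    and x: "x = real_of_int (E 0) + (\<Sum>k<M. cantor_term P E k)"
  shows "cantor_digits P x = E"
proof -
  have "(\<Sum>k<M. cantor_term P E k) < 1"
    using cantor_partial_sum_le[OF P E, of 0 M] cantor_base_pos[OF P, of M]
    by (smt (verit) cantor_base_0 div_by_1 divide_pos_pos lessThan_0 sum.empty le0)
  moreover have "0 \<le> (\<Sum>k<M. cantor_term P E k)"
    by (rule sum_nonneg) (rule cantor_term_nonneg[OF P E])
  ultimately have "E 0 = \<lfloor>x\<rfloor>" unfolding x by linarith
  moreover have "infinite {n. n \<ge> 1 \<and> E n \<noteq> P n - 1}"
  proof (rule infinite_super)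
    show "{M<..} \<subseteq> {n. n \<ge> 1 \<and> E n \<noteq> P n - 1}"
    proof
      fix n assume "n \<in> {M<..}"
      then have "E n = 0" "1 \<le> n" "2 \<le> P n" using z P by (auto simp: basic_sequence_def)
      then show "n \<in> {n. n \<ge> 1 \<and> E n \<noteq> P n - 1}" by simp
    qed
  qed (rule infinite_Ioi)
  ultimately have "cantor_expansion P x E"
    using E cantor_term_eventually_zero_sums[of M E P] z by (simp add: cantor_expansion_iff x)
  then show ?thesis
    using cantor_expansion_unique[OF P] cantor_digits_expansion[OF P] by blast
qed

text \<open>Three such points near an arbitrary \<open>c\<close> exclude increasing and decreasing
  behaviour at once.\<close>

lemma psi_peak:
  assumes P: "basic_sequence P" and Q: "basic_sequence Q" and less: "Q (Suc n) < P (Suc n)"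
    and near: "1 / cantor_base P n < d"
  shows "\<exists>x y z. c - d < x \<and> x < y \<and> y < z \<and> z < c + d \<and>
           psi P Q x < psi P Q y \<and> psi P Q z < psi P Q y"
proof -
  let ?C = "cantor_digits P c"
  note admC = cantor_digits_admissible[OF P, of c]
  \<comment> \<open>The digits of \<open>c\<close> up to position \<open>n\<close>, including the
    integer part in position 0, then \<open>i\<close>, \<open>j\<close> and zeros.\<close>
  define E where "E i j = (\<lambda>k. if k \<le> n then ?C k else if k = Suc n then i
    else if k = Suc (Suc n) then j else (0::int))" for i j
  \<comment> \<open>\<open>S\<close> is the left end of the cylinder of order \<open>n\<close>
    around \<open>c\<close>, and \<open>T\<close> is the contribution of its fixed digits to
    \<open>psi\<close>.\<close>
  define S where "S = real_of_int (?C 0) + (\<Sum>k<n. cantor_term P ?C k)"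
  define T where "T = (\<Sum>k<n. cantor_term Q (\<lambda>k. min (?C k) (Q k - 1)) k)"
  define X where "X i j = S + real_of_int i / cantor_base P (Suc n)
    + real_of_int j / cantor_base P (Suc (Suc n))" for i j
  have P2: "2 \<le> P (Suc (Suc n))" and Q2: "2 \<le> Q (Suc n)" "2 \<le> Q (Suc (Suc n))"
    using basic_sequence_ge P Q by blast+
  have Bp: "0 < cantor_base P k" "0 < cantor_base Q k" for k
    using cantor_base_pos P Q by blast+
  have adm: "admissible P (E i j)" if "i \<in> {0..P (Suc n) - 1}" "j \<in> {0, 1}" for i j
    unfolding admissible_def
  proof (intro allI impI)
    fix k :: nat assume "1 \<le> k"
    then have "2 \<le> P k" "?C k \<in> {0..P k - 1}"
      using P admC by (auto simp: basic_sequence_def admissible_def)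
    then show "E i j k \<in> {0..P k - 1}" using that by (auto simp: E_def)
  qed
  have XS: "X i j = real_of_int (E i j 0) + (\<Sum>k<Suc (Suc n). cantor_term P (E i j) k)" for i j
    by (simp add: X_def S_def E_def cantor_term_def)
  have dig: "cantor_digits P (X i j) = E i j" if "i \<in> {0..P (Suc n) - 1}" "j \<in> {0, 1}" for i j
    by (rule cantor_digits_finite_expansion[OF P adm[OF that] _ XS]) (auto simp: E_def)
  have psi: "psi P Q (X i j) = T + real_of_int (min i (Q (Suc n) - 1)) / cantor_base Q (Suc n)
      + real_of_int j / cantor_base Q (Suc (Suc n))"
    if "i \<in> {0..P (Suc n) - 1}" "j \<in> {0, 1}" for i j
  proof -
    let ?G = "\<lambda>k. min (E i j k) (Q k - 1)"
    have zero: "?G k = 0" if "Suc (Suc n) < k" for k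
    proof -
      have "2 \<le> Q k" using Q that by (simp add: basic_sequence_def)
      then show ?thesis using that by (simp add: E_def)
    qed
    \<comment> \<open>The digit \<open>j\<close> is 0 or 1 and \<open>Q\<close> is at least 2, so
      \<open>j\<close> survives truncation.\<close>
    have "min j (Q (Suc (Suc n)) - 1) = j" using that(2) Q2 by auto
    moreover have "psi P Q (X i j) = (\<Sum>k<Suc (Suc n). cantor_term Q ?G k)"
      unfolding psi_eq_suminf dig[OF that]
      by (rule sums_unique[symmetric]) (rule cantor_term_eventually_zero_sums[OF zero])
    ultimately show ?thesis by (simp add: T_def E_def cantor_term_def)
  qed
  \<comment> \<open>Both \<open>c\<close> and \<open>X i j\<close> lie in the interval from
    \<open>S\<close> to \<open>S + 1 / cantor_base P n\<close>, whose length is less than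
    \<open>d\<close>.\<close>
  have near_c: "c - d < X i j \<and> X i j < c + d" if "i \<in> {0..P (Suc n) - 1}" "j \<in> {0, 1}" for i j
  proof -
    have S': "S = real_of_int (E i j 0) + (\<Sum>k<n. cantor_term P (E i j) k)"
      by (simp add: S_def E_def cantor_term_def)
    have "0 \<le> cantor_term P (E i j) n + cantor_term P (E i j) (Suc n)"
      using cantor_term_nonneg[OF P adm[OF that]] by simp
    then have "S \<le> X i j" unfolding XS S' by simp
    moreover have "X i j \<le> S + 1 / cantor_base P n"
    proof -
      have "X i j \<le> S + 1 / cantor_base P n - 1 / cantor_base P (Suc (Suc n))"
        using cantor_partial_sum_le[OF P adm[OF that], of n "Suc (Suc n)"] unfolding XS S' by simp
      moreover have "0 < 1 / cantor_base P (Suc (Suc n))" using Bp(1) by simp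
      ultimately show ?thesis by linarith
    qed
    moreover have "S \<le> c" "c \<le> S + 1 / cantor_base P n"
      using cantor_value_ge[OF P admC, of n] cantor_value_le[OF P admC, of n]
      by (simp_all add: S_def cantor_digits_suminf[OF P] cantor_digits_0[OF P])
    ultimately show ?thesis using near by linarith
  qed
  let ?q = "Q (Suc n)"
  have q: "?q - 1 \<in> {0..P (Suc n) - 1}" "?q \<in> {0..P (Suc n) - 1}" using Q2 less by auto
  have "X (?q - 1) 0 < X (?q - 1) 1" using Bp(1)[of "Suc (Suc n)"] by (simp add: X_def)
  moreover have "X (?q - 1) 1 < X ?q 0"
  proof -
    have "1 / cantor_base P (Suc (Suc n)) < 1 / cantor_base P (Suc n)"
      using Bp(1)[of "Suc n"] P2 by (simp add: cantor_base_Suc[of P "Suc n"] field_simps)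
    then show ?thesis by (simp add: X_def diff_divide_distrib)
  qed
  \<comment> \<open>Both \<open>?q - 1\<close> and \<open>?q\<close> truncate to
    \<open>?q - 1\<close>, so the values differ only through \<open>j\<close>.\<close>
  moreover have "psi P Q (X (?q - 1) 0) < psi P Q (X (?q - 1) 1)"
    "psi P Q (X ?q 0) < psi P Q (X (?q - 1) 1)"
    using Bp(2)[of "Suc (Suc n)"] by (simp_all add: psi[OF q(1)] psi[OF q(2)])
  moreover have "c - d < X (?q - 1) 0" "X ?q 0 < c + d" using near_c q by auto
  ultimately show ?thesis by blast
qed

theorem theorem2p25:
  fixes P Q :: "nat \<Rightarrow> int"
  assumes "basic_sequence P" and "basic_sequence Q"
  shows "(\<not> (\<exists>I :: real set. is_interval I \<and> (\<exists>a\<in>I. \<exists>b\<in>I. a < b) \<and>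
              (mono_on I (psi P Q) \<or> antimono_on I (psi P Q))))
         \<longleftrightarrow> infinite {n. n \<ge> 1 \<and> P n > Q n}"
proof (intro iffI notI)
  assume none: "\<not> (\<exists>I :: real set. is_interval I \<and> (\<exists>a\<in>I. \<exists>b\<in>I. a < b) \<and>
              (mono_on I (psi P Q) \<or> antimono_on I (psi P Q)))"
    and fin: "finite {n. n \<ge> 1 \<and> P n > Q n}"
  obtain N where N: "\<And>n. n \<ge> 1 \<Longrightarrow> P n > Q n \<Longrightarrow> n \<le> N"
    using fin finite_nat_set_iff_bounded_le by auto
  let ?I = "{0..<1 / cantor_base P N}"
  have "P n \<le> Q n" if "N < n" for n
    using N[of n] that by (cases "P n \<le> Q n") auto
  then have "mono_on ?I (psi P Q)" by (rule psi_mono_on_cylinder[OF assms])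
  moreover have "is_interval ?I" by (rule is_interval_co)
  moreover have "\<exists>a\<in>?I. \<exists>b\<in>?I. a < b"
  proof -
    have "0 < 1 / cantor_base P N" using cantor_base_pos[OF assms(1)] by simp
    then obtain b where "0 < b" "b < 1 / cantor_base P N" using dense by blast
    then have "0 \<in> ?I" "b \<in> ?I" using \<open>0 < 1 / cantor_base P N\<close> by simp_all
    with \<open>0 < b\<close> show ?thesis by blast
  qed
  ultimately show False using none by blast
next
  assume inf: "infinite {n. n \<ge> 1 \<and> P n > Q n}"
    and "\<exists>I :: real set. is_interval I \<and> (\<exists>a\<in>I. \<exists>b\<in>I. a < b) \<and>
              (mono_on I (psi P Q) \<or> antimono_on I (psi P Q))"
  then obtain I :: "real set" and a b where I: "is_interval I" and ab: "a \<in> I" "b \<in> I" "a < b"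
    and mono: "mono_on I (psi P Q) \<or> antimono_on I (psi P Q)" by blast
  \<comment> \<open>With this radius the neighbourhood of the midpoint is exactly the open interval
    from \<open>a\<close> to \<open>b\<close>.\<close>
  define d where "d = (b - a) / 2"
  have "0 < d" using ab by (simp add: d_def)
  obtain M where "1 / d < 2 ^ M" using real_arch_pow[of 2] by auto
  obtain n where n: "M < n" "Q n < P n"
    using inf by (auto simp: infinite_nat_iff_unbounded)
  \<comment> \<open>\<open>psi_peak\<close> counts the fixed digits before the position
    \<open>n\<close> with \<open>Q n < P n\<close>, hence the shift; \<open>M < n\<close> still
    leaves \<open>M \<le> m\<close>.\<close>
  then obtain m where m: "n = Suc m" "M \<le> m" by (cases n) auto
  have "1 / d < cantor_base P m"
    using \<open>1 / d < 2 ^ M\<close> cantor_base_ge[OF assms(1), of M] cantor_base_mono[OF assms(1) m(2)]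
    by linarith
  then have "1 / cantor_base P m < d"
    using \<open>0 < d\<close> cantor_base_pos[OF assms(1), of m] by (simp add: field_simps)
  then obtain x y z where "(a + b) / 2 - d < x" "x < y" "y < z" "z < (a + b) / 2 + d"
    and psi: "psi P Q x < psi P Q y" "psi P Q z < psi P Q y"
    using psi_peak[OF assms, of m d "(a + b) / 2"] n m by blast
  moreover have "(a + b) / 2 - d = a" "(a + b) / 2 + d = b" by (simp_all add: d_def field_simps)
  ultimately have order: "a \<le> x" "x \<le> y" "y \<le> z" "z \<le> b" by auto
  have "x \<in> I" "y \<in> I" "z \<in> I"
    using order by (auto intro: mem_is_interval_1_I[OF I ab(1,2)])
  \<comment> \<open>The first alternative comes from the increasing case, the second from the
    decreasing one.\<close>
  then have "psi P Q y \<le> psi P Q z \<or> psi P Q y \<le> psi P Q x"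
    using mono order(2,3) by (meson monotone_onD)
  with psi show False by linarith
qed

end
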